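(* Every quasicontinuous dcpo is SCL-faithful.
   Context: A dcpo is a poset in which every (nonempty) directed subset has a supremum. A subset $A$ of a dcpo $P$ is Scott closed if it is a lower set and $\bigvee D\in A$ for every directed $D\subseteq A$. $C_\sigma(P)$ is the lattice of all Scott closed subsets of $P$ ordered by inclusion. A dcpo $P$ is SCL-faithful if for every dcpo $Q$, $C_\sigma(P)\cong C_\sigma(Q)$ (as lattices) implies $P\cong Q$ (as posets). A finite subset $F$ of a dcpo $P$ is way-below $a\in P$, written $F\ll a$, if for every directed $D\subseteq P$, $a\le\bigvee D$ implies $D\cap{\uparrow}F\neq\emptyset$, where ${\uparrow}F=\{x: y\le x\text{ for some }y\in F\}$. Let $fin(x)=\{F: F\text{ finite and }F\ll x\}$. A dcpo $P$ is quasicontinuous if for every $x\in P$ the family $fin(x)$ is directed (it is nonempty, and for all $F_1,F_2\in fin(x)$ there is $F\in fin(x)$ with $F\subseteq{\uparrow}F_1\cap{\uparrow}F_2$) and for every $y$ with $x\not\le y$ there is $F\in fin(x)$ with $y\notin{\uparrow}F$. *)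

theory Defs
  imports "HOL-Algebra.Lattice"
begin

text \<open>
  Posets are carrier-based, in the sense of the locale \<^locale>\<open>partial_order\<close>; in particular the
  empty poset is allowed. The relation \<^const>\<open>le\<close> is unconstrained outside the carrier, so every
  definition below is relativised to it.
\<close>

definition directed :: "'a gorder \<Rightarrow> 'a set \<Rightarrow> bool" where
  "directed P D \<longleftrightarrow> D \<subseteq> carrier P \<and> D \<noteq> {} \<and>
     (\<forall>x\<in>D. \<forall>y\<in>D. \<exists>z\<in>D. x \<sqsubseteq>\<^bsub>P\<^esub> z \<and> y \<sqsubseteq>\<^bsub>P\<^esub> z)"

locale dcpo = partial_order P for P :: "'a gorder" (structure) +
  assumes directed_has_lub: "directed P D \<Longrightarrow> \<exists>s. is_lub P s D"

definition scott_closed :: "'a gorder \<Rightarrow> 'a set \<Rightarrow> bool" where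
  "scott_closed P A \<longleftrightarrow> A \<subseteq> carrier P \<and>
     (\<forall>x\<in>carrier P. \<forall>y\<in>A. x \<sqsubseteq>\<^bsub>P\<^esub> y \<longrightarrow> x \<in> A) \<and>
     (\<forall>D. directed P D \<and> D \<subseteq> A \<longrightarrow> \<Squnion>\<^bsub>P\<^esub>D \<in> A)"

definition C_sigma :: "'a gorder \<Rightarrow> 'a set gorder" where
  "C_sigma P = \<lparr>carrier = {A. scott_closed P A}, eq = (=), le = (\<subseteq>)\<rparr>"

definition poset_isomorphic :: "'a gorder \<Rightarrow> 'b gorder \<Rightarrow> bool" where
  "poset_isomorphic P Q \<longleftrightarrow> (\<exists>f. bij_betw f (carrier P) (carrier Q) \<and> order_emb P Q f)"

definition lattice_isomorphic :: "'a gorder \<Rightarrow> 'b gorder \<Rightarrow> bool" where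
  "lattice_isomorphic L M \<longleftrightarrow>
     (\<exists>f. bij_betw f (carrier L) (carrier M) \<and> join_pres L M f \<and> meet_pres L M f)"

text \<open>
  HOL cannot quantify over types inside a formula, so the type of the carrier of the competing
  dcpo \<open>Q\<close> is a parameter. A theorem about \<open>SCL_faithful TYPE('b) P\<close> with \<open>'b\<close> a free type
  variable, independent of the type of \<open>P\<close>, speaks about all dcpos \<open>Q\<close>.
\<close>

definition SCL_faithful :: "'b itself \<Rightarrow> 'a gorder \<Rightarrow> bool" where
  "SCL_faithful (_ :: 'b itself) P \<longleftrightarrow> dcpo P \<and>
     (\<forall>Q :: 'b gorder. dcpo Q \<and> lattice_isomorphic (C_sigma P) (C_sigma Q) \<longrightarrow>
        poset_isomorphic P Q)"

definition up_set :: "'a gorder \<Rightarrow> 'a set \<Rightarrow> 'a set" where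
  "up_set P F = {x \<in> carrier P. \<exists>y\<in>F. y \<sqsubseteq>\<^bsub>P\<^esub> x}"

definition way_below :: "'a gorder \<Rightarrow> 'a set \<Rightarrow> 'a \<Rightarrow> bool" where
  "way_below P F a \<longleftrightarrow>
     (\<forall>D. directed P D \<and> a \<sqsubseteq>\<^bsub>P\<^esub> \<Squnion>\<^bsub>P\<^esub>D \<longrightarrow> D \<inter> up_set P F \<noteq> {})"

definition fin_below :: "'a gorder \<Rightarrow> 'a \<Rightarrow> 'a set set" where
  "fin_below P x = {F. finite F \<and> F \<subseteq> carrier P \<and> way_below P F x}"

locale quasicontinuous_dcpo = dcpo +
  assumes fin_below_nonempty: "x \<in> carrier P \<Longrightarrow> fin_below P x \<noteq> {}"
    and fin_below_directed:
      "\<lbrakk>x \<in> carrier P; F\<^sub>1 \<in> fin_below P x; F\<^sub>2 \<in> fin_below P x\<rbrakk> \<Longrightarrow>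
         \<exists>F\<in>fin_below P x. F \<subseteq> up_set P F\<^sub>1 \<inter> up_set P F\<^sub>2"
    and fin_below_separates:
      "\<lbrakk>x \<in> carrier P; y \<in> carrier P; \<not> x \<sqsubseteq> y\<rbrakk> \<Longrightarrow>
         \<exists>F\<in>fin_below P x. y \<notin> up_set P F"

text \<open>
  The library predicates \<^const>\<open>join_pres\<close> and \<^const>\<open>meet_pres\<close> require both structures to be
  lattices. This is no extra hypothesis for Scott closed sets of dcpos.
\<close>

lemma (in dcpo) scott_closed_Int:
  assumes "scott_closed P A" "scott_closed P B"
  shows "scott_closed P (A \<inter> B)"
  using assms unfolding scott_closed_def by blast

lemma (in dcpo) scott_closed_Un:
  assumes A: "scott_closed P A" and B: "scott_closed P B"
  shows "scott_closed P (A \<union> B)"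
proof -
  have "\<Squnion>D \<in> A \<union> B" if D: "directed P D" "D \<subseteq> A \<union> B" for D
  proof -
    have sub: "D \<subseteq> carrier P"
      using D unfolding directed_def by blast
    have "D \<subseteq> A \<or> D \<subseteq> B"
    proof (rule ccontr)
      assume "\<not> (D \<subseteq> A \<or> D \<subseteq> B)"
      then obtain x y where xy: "x \<in> D" "x \<notin> A" "y \<in> D" "y \<notin> B"
        by blast
      then obtain z where z: "z \<in> D" "x \<sqsubseteq> z" "y \<sqsubseteq> z"
        using D unfolding directed_def by blast
      have "x \<in> carrier P" "y \<in> carrier P" "z \<in> A \<or> z \<in> B"
        using xy z sub D by auto
      then show False
        using xy z A B unfolding scott_closed_def by metis
    qed
    then show ?thesis
      using D A B unfolding scott_closed_def by blast
  qed
  moreover have "x \<in> A \<union> B" if "x \<in> carrier P" "y \<in> A \<union> B" "x \<sqsubseteq> y" for x y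
    using that A B unfolding scott_closed_def by blast
  moreover have "A \<union> B \<subseteq> carrier P"
    using A B unfolding scott_closed_def by blast
  ultimately show ?thesis
    unfolding scott_closed_def by blast
qed

lemma (in dcpo) lattice_C_sigma: "lattice (C_sigma P)"
proof unfold_locales
  fix A B assume "A \<in> carrier (C_sigma P)" "B \<in> carrier (C_sigma P)"
  then have AB: "scott_closed P A" "scott_closed P B"
    by (simp_all add: C_sigma_def)
  have "is_lub (C_sigma P) (A \<union> B) {A, B}"
    using AB scott_closed_Un[OF AB] by (auto simp: least_def Upper_def C_sigma_def)
  then show "\<exists>S. is_lub (C_sigma P) S {A, B}" by blast
  have "is_glb (C_sigma P) (A \<inter> B) {A, B}"
    using AB scott_closed_Int[OF AB] by (auto simp: greatest_def Lower_def C_sigma_def)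
  then show "\<exists>S. is_glb (C_sigma P) S {A, B}" by blast
qed (auto simp: C_sigma_def)

end

theory Submission
  imports Defs
begin

text \<open>
  Order isomorphisms of closed set lattices preserve irreducibility. If both dcpos were sober, with
  every irreducible Scott closed set a principal ideal, then \<open>P\<close> and \<open>Q\<close> could be read off their
  lattices as the posets of irreducible elements. A quasicontinuous dcpo is sober, but nothing of
  the kind is known about \<open>Q\<close>; recovering the points of \<open>Q\<close> is the real content.

  Let \<open>\<phi>\<close> be an isomorphism from the Scott closed sets of \<open>P\<close> to those of \<open>Q\<close>. For each point \<open>q\<close> of
  \<open>Q\<close> the ideal of \<open>q\<close> is irreducible, so by sobriety of \<open>P\<close> it is the image under \<open>\<phi>\<close> of the ideal
  of a point \<open>emb q\<close>. This makes \<open>emb\<close> an order embedding of \<open>Q\<close> into \<open>P\<close> with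
  \<open>\<phi> A = {q. emb q \<in> A}\<close>. Since \<open>\<phi>\<close> loses no closed set, the image \<open>E\<close> of \<open>emb\<close> is strongly dense:
  a Scott open set that contains \<open>x\<close> contains an element of \<open>E\<close> below \<open>x\<close> (lemma \<open>emb_dense\<close>).
  Quasicontinuity now forces every \<open>x\<close> to be the supremum of a directed subset of \<open>E\<close>, and \<open>E\<close> is
  closed under directed suprema because \<open>Q\<close> is a dcpo. So \<open>emb\<close> is onto (lemma \<open>emb_surj\<close>).

  Sobriety of \<open>P\<close> and surjectivity of \<open>emb\<close> are two instances of one statement, lemma
  \<open>irreducible_principal\<close>: an irreducible closed set \<open>C\<close> is the ideal of a directed supremum of
  elements of \<open>C \<inter> E\<close>, whenever \<open>E\<close> is strongly dense. Sobriety is the case of \<open>E\<close> the whole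
  carrier; surjectivity is the case of \<open>C\<close> the ideal of a point and \<open>E\<close> the image of \<open>emb\<close>.
  Its proof rests on two facts: Rudin's lemma, which extracts a directed set from a
  filtered family of finite sets, and interpolation, by which the points that a given
  finite set is way below form a Scott open set.
\<close>

section \<open>Directed suprema and Scott closed sets\<close>

definition principal_down :: "'a gorder \<Rightarrow> 'a \<Rightarrow> 'a set" where
  "principal_down P x = {y \<in> carrier P. y \<sqsubseteq>\<^bsub>P\<^esub> x}"

definition scott_irreducible :: "'a gorder \<Rightarrow> 'a set \<Rightarrow> bool" where
  "scott_irreducible P C \<longleftrightarrow> scott_closed P C \<and> C \<noteq> {} \<and>
     (\<forall>A B. scott_closed P A \<and> scott_closed P B \<and> C \<subseteq> A \<union> B \<longrightarrow> C \<subseteq> A \<or> C \<subseteq> B)"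

lemma scott_closed_lower:
  "\<lbrakk>scott_closed P A; y \<in> A; x \<in> carrier P; x \<sqsubseteq>\<^bsub>P\<^esub> y\<rbrakk> \<Longrightarrow> x \<in> A"
  unfolding scott_closed_def by blast

lemma scott_closed_carrier: "scott_closed P A \<Longrightarrow> A \<subseteq> carrier P"
  unfolding scott_closed_def by blast

lemma scott_closed_sup: "\<lbrakk>scott_closed P A; directed P D; D \<subseteq> A\<rbrakk> \<Longrightarrow> \<Squnion>\<^bsub>P\<^esub>D \<in> A"
  unfolding scott_closed_def by blast

lemma scott_closed_empty: "scott_closed P {}"
  unfolding scott_closed_def directed_def by blast

context dcpo
begin

lemma sup_is_lub: "directed P D \<Longrightarrow> is_lub P (\<Squnion>D) D"
  unfolding sup_def by (rule someI_ex) (rule directed_has_lub)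

lemma sup_carrier: "directed P D \<Longrightarrow> \<Squnion>D \<in> carrier P"
  using sup_is_lub least_closed by metis

lemma sup_upper: "\<lbrakk>directed P D; d \<in> D\<rbrakk> \<Longrightarrow> d \<sqsubseteq> \<Squnion>D"
  using sup_is_lub least_Upper_above unfolding directed_def by metis

lemma sup_least:
  assumes "directed P D" "u \<in> carrier P" "\<And>d. d \<in> D \<Longrightarrow> d \<sqsubseteq> u"
  shows "\<Squnion>D \<sqsubseteq> u"
  using least_le[OF sup_is_lub[OF assms(1)]] Upper_memI[of D P u] assms by blast

lemma singleton_directed: "x \<in> carrier P \<Longrightarrow> directed P {x}"
  unfolding directed_def by auto

lemma sup_singleton: "x \<in> carrier P \<Longrightarrow> \<Squnion>{x} = x"
  by (rule le_antisym)
    (auto intro: sup_least sup_upper sup_carrier singleton_directed)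

lemma principal_down_self: "x \<in> carrier P \<Longrightarrow> x \<in> principal_down P x"
  unfolding principal_down_def by auto

lemma principal_down_mono_iff:
  assumes "x \<in> carrier P" "y \<in> carrier P"
  shows "principal_down P x \<subseteq> principal_down P y \<longleftrightarrow> x \<sqsubseteq> y"
  using assms le_trans unfolding principal_down_def by auto

lemma principal_down_least:
  "\<lbrakk>scott_closed P A; x \<in> carrier P\<rbrakk> \<Longrightarrow> principal_down P x \<subseteq> A \<longleftrightarrow> x \<in> A"
  unfolding principal_down_def using scott_closed_lower by fastforce

lemma scott_closed_principal_down:
  assumes "x \<in> carrier P"
  shows "scott_closed P (principal_down P x)"
  unfolding scott_closed_def principal_down_def
  using assms by (auto intro: le_trans sup_least sup_carrier)

lemma scott_irreducible_principal_down:
  assumes x: "x \<in> carrier P"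
  shows "scott_irreducible P (principal_down P x)"
  using principal_down_self[OF x] principal_down_least[OF _ x] scott_closed_principal_down[OF x]
  unfolding scott_irreducible_def by blast

section \<open>Upper sets of finite sets and the way-below relation\<close>

lemma up_set_mono:
  assumes "G \<subseteq> up_set P F" "F \<subseteq> carrier P"
  shows "up_set P G \<subseteq> up_set P F"
proof
  fix x assume "x \<in> up_set P G"
  then obtain g where g: "x \<in> carrier P" "g \<in> G" "g \<sqsubseteq> x" unfolding up_set_def by blast
  then obtain f where "f \<in> F" "f \<sqsubseteq> g" "g \<in> carrier P" using assms unfolding up_set_def by blast
  with g assms show "x \<in> up_set P F" unfolding up_set_def by (blast intro: le_trans)
qed

lemma way_below_mono:
  "\<lbrakk>way_below P G x; up_set P G \<subseteq> up_set P F\<rbrakk> \<Longrightarrow> way_below P F x"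
  unfolding way_below_def by blast

lemma way_below_le:
  assumes "way_below P F x" "x \<sqsubseteq> y" "x \<in> carrier P" "y \<in> carrier P"
  shows "way_below P F y"
  using assms le_trans[OF assms(2)] sup_carrier unfolding way_below_def by blast

lemma way_below_in_up_set:
  assumes "way_below P F x" "x \<in> carrier P"
  shows "x \<in> up_set P F"
  using assms singleton_directed[OF assms(2)] sup_singleton[OF assms(2)]
  unfolding way_below_def by fastforce

lemma finite_below_union:
  assumes F: "finite F" and G: "\<And>y. y \<in> F \<Longrightarrow> G y \<in> fin_below P y"
  shows "finite (\<Union>y\<in>F. G y)" "(\<Union>y\<in>F. G y) \<subseteq> carrier P"
    "\<And>y. y \<in> F \<Longrightarrow> way_below P (\<Union>y\<in>F. G y) y"
proof -
  show "finite (\<Union>y\<in>F. G y)" "(\<Union>y\<in>F. G y) \<subseteq> carrier P"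
    using F G unfolding fin_below_def by blast+
  fix y assume y: "y \<in> F"
  have "up_set P (G y) \<subseteq> up_set P (\<Union>y\<in>F. G y)" using y unfolding up_set_def by blast
  then show "way_below P (\<Union>y\<in>F. G y) y"
    using G[OF y] way_below_mono unfolding fin_below_def by blast
qed

section \<open>Rudin's lemma\<close>

text \<open>
  Among the upper sets that contain \<open>W\<close> and contain no member of \<open>\<G>\<close>, Zorn's lemma gives a maximal
  one, \<open>V\<close>; finiteness of the members of \<open>\<G>\<close> is what makes unions of chains admissible. The wanted
  set is the part of the union of \<open>\<G>\<close> outside \<open>V\<close>. It is directed because, for \<open>x\<close> and \<open>y\<close>
  outside \<open>V\<close>, maximality says that adding the points above \<open>x\<close> to \<open>V\<close> swallows a member of
  \<open>\<G>\<close>, and likewise for \<open>y\<close>. A member of \<open>\<G>\<close> above both of these has a point outside \<open>V\<close>, and that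
  point can only lie above both \<open>x\<close> and \<open>y\<close>.
\<close>

lemma rudin:
  assumes ne: "\<G> \<noteq> {}"
    and fin: "\<And>G. G \<in> \<G> \<Longrightarrow> finite G \<and> G \<subseteq> carrier P"
    and filt: "\<And>G\<^sub>1 G\<^sub>2. \<lbrakk>G\<^sub>1 \<in> \<G>; G\<^sub>2 \<in> \<G>\<rbrakk> \<Longrightarrow> \<exists>G\<in>\<G>. G \<subseteq> up_set P G\<^sub>1 \<inter> up_set P G\<^sub>2"
    and W: "up_set P W \<subseteq> W"
    and escape: "\<And>G. G \<in> \<G> \<Longrightarrow> \<not> G \<subseteq> W"
  obtains D where "directed P D" "D \<subseteq> \<Union>\<G> - W" "\<And>G. G \<in> \<G> \<Longrightarrow> D \<inter> G \<noteq> {}"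
proof -
  define \<V> where "\<V> = {V. W \<subseteq> V \<and> up_set P V \<subseteq> V \<and> (\<forall>G\<in>\<G>. \<not> G \<subseteq> V)}"
  have "\<exists>M\<in>\<V>. \<forall>X\<in>\<V>. M \<subseteq> X \<longrightarrow> X = M"
  proof (rule subset_Zorn_nonempty)
    show "\<V> \<noteq> {}" using W escape unfolding \<V>_def by blast
    fix \<C> assume C: "\<C> \<noteq> {}" "subset.chain \<V> \<C>"
    then have sub: "\<C> \<subseteq> \<V>" unfolding subset_chain_def by blast
    have "\<not> G \<subseteq> \<Union>\<C>" if G: "G \<in> \<G>" for G
    proof
      assume "G \<subseteq> \<Union>\<C>"
      then obtain V where "V \<in> \<C>" "G \<subseteq> V"
        using finite_subset_Union_chain[OF _ _ C] fin[OF G] by blast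
      then show False using sub G unfolding \<V>_def by blast
    qed
    moreover have "up_set P (\<Union>\<C>) \<subseteq> \<Union>\<C>"
      using sub unfolding \<V>_def up_set_def by blast
    ultimately show "\<Union>\<C> \<in> \<V>" using C(1) sub unfolding \<V>_def by blast
  qed
  then obtain V where V: "V \<in> \<V>" and max: "\<And>X. \<lbrakk>X \<in> \<V>; V \<subseteq> X\<rbrakk> \<Longrightarrow> X = V" by blast
  have upV: "y \<in> V" if "x \<in> V" "x \<sqsubseteq> y" "y \<in> carrier P" for x y
    using V that unfolding \<V>_def up_set_def by blast
  have meets: "\<not> G \<subseteq> V" if "G \<in> \<G>" for G using V that unfolding \<V>_def by blast
  have above: "\<exists>G\<in>\<G>. G \<subseteq> V \<union> {z \<in> carrier P. x \<sqsubseteq> z}" if x: "x \<in> carrier P" "x \<notin> V" for x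
  proof (rule ccontr)
    let ?X = "V \<union> {z \<in> carrier P. x \<sqsubseteq> z}"
    assume "\<not> ?thesis"
    moreover have "up_set P ?X \<subseteq> ?X"
      unfolding up_set_def using x upV le_trans by blast
    moreover have "W \<subseteq> ?X" using V unfolding \<V>_def by blast
    ultimately have "?X \<in> \<V>" unfolding \<V>_def by blast
    then have "?X = V" by (rule max) blast
    then show False using x by blast
  qed
  let ?D = "\<Union>\<G> - V"
  have "\<exists>z\<in>?D. x \<sqsubseteq> z \<and> y \<sqsubseteq> z" if xy: "x \<in> ?D" "y \<in> ?D" for x y
  proof -
    have c: "x \<in> carrier P" "y \<in> carrier P" using xy fin by blast+
    obtain G\<^sub>1 where G1: "G\<^sub>1 \<in> \<G>" "G\<^sub>1 \<subseteq> V \<union> {z \<in> carrier P. x \<sqsubseteq> z}"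
      using above[of x] xy c by blast
    obtain G\<^sub>2 where G2: "G\<^sub>2 \<in> \<G>" "G\<^sub>2 \<subseteq> V \<union> {z \<in> carrier P. y \<sqsubseteq> z}"
      using above[of y] xy c by blast
    obtain G where G: "G \<in> \<G>" "G \<subseteq> up_set P G\<^sub>1 \<inter> up_set P G\<^sub>2" using filt[OF G1(1) G2(1)] by blast
    obtain z where z: "z \<in> G" "z \<notin> V" using meets G by blast
    obtain g\<^sub>1 g\<^sub>2 where g: "g\<^sub>1 \<in> G\<^sub>1" "g\<^sub>1 \<sqsubseteq> z" "g\<^sub>2 \<in> G\<^sub>2" "g\<^sub>2 \<sqsubseteq> z" "z \<in> carrier P"
      using G z unfolding up_set_def by blast
    have "g\<^sub>1 \<notin> V" "g\<^sub>2 \<notin> V" using upV g z by blast+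
    then have "x \<sqsubseteq> g\<^sub>1" "y \<sqsubseteq> g\<^sub>2" "g\<^sub>1 \<in> carrier P" "g\<^sub>2 \<in> carrier P" using g G1 G2 by blast+
    then have "x \<sqsubseteq> z" "y \<sqsubseteq> z" using g c by (blast intro: le_trans)+
    then show ?thesis using z G by blast
  qed
  moreover have "?D \<subseteq> carrier P" "?D \<noteq> {}" using fin ne meets by blast+
  ultimately have "directed P ?D" unfolding directed_def by blast
  moreover have "?D \<subseteq> \<Union>\<G> - W" using V unfolding \<V>_def by blast
  moreover have "?D \<inter> G \<noteq> {}" if "G \<in> \<G>" for G using that meets by blast
  ultimately show ?thesis by (rule that)
qed

end

section \<open>Interpolation and sobriety of quasicontinuous dcpos\<close>

context quasicontinuous_dcpo
begin

text \<open>
  The family \<open>\<G>\<close> of finite sets reachable from \<open>x\<close> in two way-below steps is filtered and still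
  separates \<open>x\<close> from every point that is not above it. If no member of \<open>\<G>\<close> were contained in
  the upper set of \<open>H\<close>, Rudin's lemma would give a directed set \<open>D\<close> meeting all members of \<open>\<G>\<close>
  but avoiding that upper set. Meeting all members forces \<open>x \<sqsubseteq> \<Squnion>D\<close>, and then \<open>H\<close> being way
  below \<open>x\<close> forces \<open>D\<close> into the upper set.
\<close>

lemma interpolation:
  assumes x: "x \<in> carrier P" and H: "H \<subseteq> carrier P" "way_below P H x"
  shows "\<exists>F\<in>fin_below P x. \<forall>y\<in>F. way_below P H y"
proof (rule ccontr)
  assume neg: "\<not> ?thesis"
  define \<G> where "\<G> = {G. finite G \<and> G \<subseteq> carrier P \<and> (\<exists>F\<in>fin_below P x. \<forall>y\<in>F. way_below P G y)}"
  have mem: "(\<Union>y\<in>F. G y) \<in> \<G>"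
    if "F \<in> fin_below P x" "\<And>y. y \<in> F \<Longrightarrow> G y \<in> fin_below P y" for F G
    using finite_below_union[of F G] that unfolding \<G>_def fin_below_def[of P x] by blast
  have car: "y \<in> carrier P" if "F \<in> fin_below P x" "y \<in> F" for F y
    using that unfolding fin_below_def by blast
  have "\<exists>D. directed P D \<and> D \<subseteq> \<Union>\<G> - up_set P H \<and> (\<forall>G\<in>\<G>. D \<inter> G \<noteq> {})"
  proof (rule rudin[of \<G> "up_set P H"])
    obtain F where F: "F \<in> fin_below P x" using fin_below_nonempty[OF x] by blast
    then have "\<forall>y\<in>F. \<exists>G. G \<in> fin_below P y" using fin_below_nonempty car by blast
    then obtain G where "\<And>y. y \<in> F \<Longrightarrow> G y \<in> fin_below P y" by metis
    with F show "\<G> \<noteq> {}" using mem by blast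
    show "finite G \<and> G \<subseteq> carrier P" if "G \<in> \<G>" for G using that unfolding \<G>_def by blast
    show "up_set P (up_set P H) \<subseteq> up_set P H" by (rule up_set_mono[OF subset_refl H(1)])
    show "\<not> G \<subseteq> up_set P H" if "G \<in> \<G>" for G
    proof
      assume "G \<subseteq> up_set P H"
      then have "up_set P G \<subseteq> up_set P H" using H up_set_mono by blast
      then show False using neg that way_below_mono unfolding \<G>_def by blast
    qed
    fix G\<^sub>1 G\<^sub>2 assume "G\<^sub>1 \<in> \<G>" "G\<^sub>2 \<in> \<G>"
    then obtain F\<^sub>1 F\<^sub>2 where G: "finite G\<^sub>1" "G\<^sub>1 \<subseteq> carrier P" "finite G\<^sub>2" "G\<^sub>2 \<subseteq> carrier P"
      and F: "F\<^sub>1 \<in> fin_below P x" "\<forall>y\<in>F\<^sub>1. way_below P G\<^sub>1 y"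
        "F\<^sub>2 \<in> fin_below P x" "\<forall>y\<in>F\<^sub>2. way_below P G\<^sub>2 y"
      unfolding \<G>_def by blast
    obtain F where F': "F \<in> fin_below P x" "F \<subseteq> up_set P F\<^sub>1 \<inter> up_set P F\<^sub>2"
      using fin_below_directed[OF x F(1,3)] by blast
    have "\<exists>G'. G' \<in> fin_below P y \<and> G' \<subseteq> up_set P G\<^sub>1 \<inter> up_set P G\<^sub>2" if y: "y \<in> F" for y
    proof -
      obtain y\<^sub>1 y\<^sub>2 where "y\<^sub>1 \<in> F\<^sub>1" "y\<^sub>1 \<sqsubseteq> y" "y\<^sub>2 \<in> F\<^sub>2" "y\<^sub>2 \<sqsubseteq> y"
        using F' y unfolding up_set_def by blast
      then have "way_below P G\<^sub>1 y" "way_below P G\<^sub>2 y"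
        using F way_below_le car F'(1) y by meson+
      then have "G\<^sub>1 \<in> fin_below P y" "G\<^sub>2 \<in> fin_below P y"
        using G unfolding fin_below_def by blast+
      then show ?thesis using fin_below_directed[OF car[OF F'(1) y]] by blast
    qed
    then obtain G' where G': "\<And>y. y \<in> F \<Longrightarrow> G' y \<in> fin_below P y \<and> G' y \<subseteq> up_set P G\<^sub>1 \<inter> up_set P G\<^sub>2"
      by metis
    then have "(\<Union>y\<in>F. G' y) \<in> \<G>" by (intro mem F'(1)) blast
    moreover have "(\<Union>y\<in>F. G' y) \<subseteq> up_set P G\<^sub>1 \<inter> up_set P G\<^sub>2" using G' by blast
    ultimately show "\<exists>G\<in>\<G>. G \<subseteq> up_set P G\<^sub>1 \<inter> up_set P G\<^sub>2" by (rule bexI[rotated])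
  qed blast
  then obtain D where D: "directed P D" "D \<subseteq> \<Union>\<G> - up_set P H"
    and meet: "\<And>G. G \<in> \<G> \<Longrightarrow> D \<inter> G \<noteq> {}"
    by blast
  have "\<not> x \<sqsubseteq> \<Squnion>D" using D H unfolding way_below_def by blast
  then obtain F where F: "F \<in> fin_below P x" "\<Squnion>D \<notin> up_set P F"
    using fin_below_separates[OF x sup_carrier[OF D(1)]] by blast
  have "\<exists>G. G \<in> fin_below P y \<and> \<Squnion>D \<notin> up_set P G" if "y \<in> F" for y
    using fin_below_separates[OF car[OF F(1) that] sup_carrier[OF D(1)]] that F(2) sup_carrier[OF D(1)]
    unfolding up_set_def by blast
  then obtain G where G: "\<And>y. y \<in> F \<Longrightarrow> G y \<in> fin_below P y \<and> \<Squnion>D \<notin> up_set P (G y)" by metis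
  then have "(\<Union>y\<in>F. G y) \<in> \<G>" by (intro mem F(1)) blast
  then obtain y d where "y \<in> F" "d \<in> G y" "d \<in> D" using meet by blast
  then have "\<Squnion>D \<in> up_set P (G y)"
    unfolding up_set_def using sup_upper[OF D(1)] sup_carrier[OF D(1)] by blast
  with G \<open>y \<in> F\<close> show False by blast
qed

text \<open>
  By interpolation the points that \<open>H\<close> is way below form a Scott open set; the set here is its
  complement relative to \<open>A\<close>.
\<close>

lemma scott_closed_not_way_below:
  assumes A: "scott_closed P A" and H: "H \<subseteq> carrier P"
  shows "scott_closed P {y \<in> A. \<not> way_below P H y}"
proof -
  have "\<not> way_below P H (\<Squnion>D)" if D: "directed P D" "D \<subseteq> {y \<in> A. \<not> way_below P H y}" for D
  proof
    assume "way_below P H (\<Squnion>D)"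
    then obtain F where F: "F \<in> fin_below P (\<Squnion>D)" "\<And>y. y \<in> F \<Longrightarrow> way_below P H y"
      using interpolation[OF sup_carrier[OF D(1)] H] by blast
    then have "D \<inter> up_set P F \<noteq> {}"
      using D(1) sup_carrier[OF D(1)] unfolding fin_below_def way_below_def by blast
    then obtain d y where dy: "d \<in> D" "d \<in> carrier P" "y \<in> F" "y \<sqsubseteq> d" unfolding up_set_def by blast
    then have "way_below P H d"
      using F way_below_le unfolding fin_below_def by blast
    then show False using dy D by blast
  qed
  then show ?thesis
    using A way_below_le unfolding scott_closed_def by blast
qed

text \<open>
  The third assumption expresses strong density: it suffices to test it on the sets of points that
  a given finite set is way below, which form a base of the Scott topology. The finite subsets
  of \<open>E\<close> that are way below some point of \<open>C\<close> form a family \<open>\<G>\<close>. It is filtered because \<open>C\<close>, being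
  irreducible, has a common point in any two of the basic open sets that it meets, and because
  density allows every finite set in the way-below approximation to be refined to a subset of
  \<open>E\<close>. Rudin's lemma then gives a directed set in \<open>C \<inter> E\<close> meeting every member of \<open>\<G>\<close>, so its
  supremum cannot be separated from any point of \<open>C\<close>.
\<close>

lemma irreducible_principal:
  assumes C: "scott_irreducible P C"
    and E: "E \<subseteq> carrier P"
    and dense: "\<And>x F. \<lbrakk>x \<in> carrier P; F \<in> fin_below P x\<rbrakk> \<Longrightarrow> \<exists>e\<in>E. e \<sqsubseteq> x \<and> way_below P F e"
  obtains D where "directed P D" "D \<subseteq> C \<inter> E" "C = principal_down P (\<Squnion>D)"
proof -
  have closed: "scott_closed P C" and "C \<noteq> {}" using C unfolding scott_irreducible_def by blast+
  have C_car: "C \<subseteq> carrier P" using closed by (rule scott_closed_carrier)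
  define \<G> where "\<G> = {G. G \<subseteq> E \<and> (\<exists>a\<in>C. G \<in> fin_below P a)}"
  have refine: "\<exists>G\<in>\<G>. G \<subseteq> up_set P F" if a: "a \<in> C" and F: "F \<in> fin_below P a" for a F
  proof -
    have aP: "a \<in> carrier P" using a C_car by blast
    have F': "F \<subseteq> carrier P" "finite F" "way_below P F a" using F unfolding fin_below_def by blast+
    \<comment> \<open>Pull each point of an interpolated set down into \<open>E\<close>: the result is still way below \<open>a\<close>
      because it lies lower, and still inside the upper set of \<open>F\<close> by density.\<close>
    obtain F\<^sub>1 where F1: "F\<^sub>1 \<in> fin_below P a" "\<And>y. y \<in> F\<^sub>1 \<Longrightarrow> way_below P F y"
      using interpolation[OF aP F'(1,3)] by blast
    have "\<exists>e\<in>E. e \<sqsubseteq> y \<and> way_below P F e" if "y \<in> F\<^sub>1" for y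
    proof (rule dense)
      show "y \<in> carrier P" using that F1(1) unfolding fin_below_def by blast
      show "F \<in> fin_below P y" using F' F1(2)[OF that] unfolding fin_below_def by blast
    qed
    then obtain e where e: "\<And>y. y \<in> F\<^sub>1 \<Longrightarrow> e y \<in> E \<and> e y \<sqsubseteq> y \<and> way_below P F (e y)" by metis
    have "F\<^sub>1 \<subseteq> up_set P (e ` F\<^sub>1)" using e F1(1) unfolding up_set_def fin_below_def by blast
    moreover have eP: "e ` F\<^sub>1 \<subseteq> carrier P" using e E by blast
    ultimately have "up_set P F\<^sub>1 \<subseteq> up_set P (e ` F\<^sub>1)" by (rule up_set_mono)
    then have "way_below P (e ` F\<^sub>1) a"
      using way_below_mono F1(1) unfolding fin_below_def by blast
    moreover have "finite (e ` F\<^sub>1)" using F1(1) unfolding fin_below_def by blast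
    ultimately have "e ` F\<^sub>1 \<in> fin_below P a" using eP unfolding fin_below_def by blast
    moreover have "e ` F\<^sub>1 \<subseteq> E" using e by blast
    ultimately have "e ` F\<^sub>1 \<in> \<G>" using a unfolding \<G>_def by blast
    moreover have "e ` F\<^sub>1 \<subseteq> up_set P F" using e E way_below_in_up_set by blast
    ultimately show ?thesis by blast
  qed
  have below: "G \<inter> C \<noteq> {}" if G: "G \<in> \<G>" for G
  proof -
    obtain a where a: "a \<in> C" "G \<in> fin_below P a" using G unfolding \<G>_def by blast
    then have "a \<in> up_set P G" using way_below_in_up_set C_car unfolding fin_below_def by blast
    then show ?thesis
      using a scott_closed_lower[OF closed] unfolding up_set_def fin_below_def by blast
  qed
  have "\<exists>D. directed P D \<and> D \<subseteq> \<Union>\<G> - (carrier P - C) \<and> (\<forall>G\<in>\<G>. D \<inter> G \<noteq> {})"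
  proof (rule rudin[of \<G> "carrier P - C"])
    show "\<G> \<noteq> {}" using \<open>C \<noteq> {}\<close> C_car fin_below_nonempty refine by blast
    show "finite G \<and> G \<subseteq> carrier P" if "G \<in> \<G>" for G
      using that unfolding \<G>_def fin_below_def by blast
    show "up_set P (carrier P - C) \<subseteq> carrier P - C"
      using scott_closed_lower[OF closed] unfolding up_set_def by blast
    show "\<not> G \<subseteq> carrier P - C" if "G \<in> \<G>" for G using below that by blast
    fix G\<^sub>1 G\<^sub>2 assume G: "G\<^sub>1 \<in> \<G>" "G\<^sub>2 \<in> \<G>"
    then have G': "G\<^sub>1 \<subseteq> carrier P" "G\<^sub>2 \<subseteq> carrier P" "finite G\<^sub>1" "finite G\<^sub>2"
      unfolding \<G>_def fin_below_def by blast+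
    have "\<exists>a\<in>C. way_below P G\<^sub>1 a \<and> way_below P G\<^sub>2 a"
    proof (rule ccontr)
      assume "\<not> ?thesis"
      then have "C \<subseteq> {y \<in> C. \<not> way_below P G\<^sub>1 y} \<union> {y \<in> C. \<not> way_below P G\<^sub>2 y}" by blast
      then have "C \<subseteq> {y \<in> C. \<not> way_below P G\<^sub>1 y} \<or> C \<subseteq> {y \<in> C. \<not> way_below P G\<^sub>2 y}"
        using C scott_closed_not_way_below[OF closed G'(1)] scott_closed_not_way_below[OF closed G'(2)]
        unfolding scott_irreducible_def by blast
      then show False using G unfolding \<G>_def fin_below_def by blast
    qed
    then obtain a where a: "a \<in> C" "G\<^sub>1 \<in> fin_below P a" "G\<^sub>2 \<in> fin_below P a"
      using G' unfolding fin_below_def by blast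
    have "a \<in> carrier P" using a(1) C_car by blast
    then obtain F where F: "F \<in> fin_below P a" "F \<subseteq> up_set P G\<^sub>1 \<inter> up_set P G\<^sub>2"
      using fin_below_directed[OF _ a(2,3)] by blast
    obtain G where "G \<in> \<G>" "G \<subseteq> up_set P F" using refine[OF a(1) F(1)] by blast
    moreover have "up_set P F \<subseteq> up_set P G\<^sub>1" "up_set P F \<subseteq> up_set P G\<^sub>2"
      by (rule up_set_mono; use F G' in blast)+
    ultimately show "\<exists>G\<in>\<G>. G \<subseteq> up_set P G\<^sub>1 \<inter> up_set P G\<^sub>2" by blast
  qed blast
  then obtain D where D: "directed P D" "D \<subseteq> \<Union>\<G> - (carrier P - C)"
    and meet: "\<And>G. G \<in> \<G> \<Longrightarrow> D \<inter> G \<noteq> {}"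
    by blast
  have sub: "D \<subseteq> C \<inter> E" using D unfolding \<G>_def directed_def by blast
  have s: "\<Squnion>D \<in> C" "\<Squnion>D \<in> carrier P" using scott_closed_sup[OF closed D(1)] sub C_car by blast+
  have "a \<sqsubseteq> \<Squnion>D" if a: "a \<in> C" for a
  proof (rule ccontr)
    assume "\<not> a \<sqsubseteq> \<Squnion>D"
    then obtain F where F: "F \<in> fin_below P a" "\<Squnion>D \<notin> up_set P F"
      using fin_below_separates a C_car s by blast
    then obtain G where G: "G \<in> \<G>" "G \<subseteq> up_set P F" using refine a by blast
    then obtain d where d: "d \<in> D" "d \<in> G" using meet by blast
    have "\<Squnion>D \<in> up_set P G" using d sup_upper[OF D(1)] s unfolding up_set_def by blast
    moreover have "up_set P G \<subseteq> up_set P F"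
      using G F up_set_mono unfolding fin_below_def by blast
    ultimately show False using F by blast
  qed
  then have "C = principal_down P (\<Squnion>D)"
    using C_car s scott_closed_lower[OF closed] unfolding principal_down_def by blast
  then show ?thesis using that D(1) sub by blast
qed

lemma sober:
  assumes "scott_irreducible P C"
  obtains x where "x \<in> carrier P" "C = principal_down P x"
proof -
  obtain D where "directed P D" "C = principal_down P (\<Squnion>D)"
    by (rule irreducible_principal[OF assms, of "carrier P"]) (auto simp: fin_below_def)
  then show thesis using that sup_carrier by blast
qed

end

section \<open>Recovering the points from the lattice of Scott closed sets\<close>

lemma lattice_isomorphic_imp_order_iso:
  assumes "lattice_isomorphic L M"
  obtains \<phi> where "bij_betw \<phi> (carrier L) (carrier M)"
    "\<And>A B. \<lbrakk>A \<in> carrier L; B \<in> carrier L\<rbrakk> \<Longrightarrow> \<phi> A \<sqsubseteq>\<^bsub>M\<^esub> \<phi> B \<longleftrightarrow> A \<sqsubseteq>\<^bsub>L\<^esub> B"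
proof -
  obtain \<phi> where bij: "bij_betw \<phi> (carrier L) (carrier M)" and join: "join_pres L M \<phi>"
    using assms unfolding lattice_isomorphic_def by blast
  interpret L: lattice L using join unfolding join_pres_def by blast
  interpret M: lattice M using join unfolding join_pres_def by blast
  have "\<phi> A \<sqsubseteq>\<^bsub>M\<^esub> \<phi> B \<longleftrightarrow> A \<sqsubseteq>\<^bsub>L\<^esub> B" if AB: "A \<in> carrier L" "B \<in> carrier L" for A B
  proof -
    have "\<phi> A \<in> carrier M" "\<phi> B \<in> carrier M" using bij AB by (auto simp: bij_betw_def)
    then have "\<phi> A \<sqsubseteq>\<^bsub>M\<^esub> \<phi> B \<longleftrightarrow> \<phi> A \<squnion>\<^bsub>M\<^esub> \<phi> B = \<phi> B" by (rule M.le_iff_meet)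
    also have "\<dots> \<longleftrightarrow> \<phi> (A \<squnion>\<^bsub>L\<^esub> B) = \<phi> B" using join AB unfolding join_pres_def by simp
    also have "\<dots> \<longleftrightarrow> A \<squnion>\<^bsub>L\<^esub> B = B"
      by (rule inj_on_eq_iff[OF bij_betw_imp_inj_on[OF bij] L.join_closed[OF AB] AB(2)])
    also have "\<dots> \<longleftrightarrow> A \<sqsubseteq>\<^bsub>L\<^esub> B" using L.le_iff_meet[OF AB] by simp
    finally show ?thesis .
  qed
  with bij show thesis by (rule that)
qed

locale scott_closed_iso = P: dcpo P + Q: dcpo Q
  for P :: "'a gorder" and Q :: "'b gorder" +
  fixes \<phi> :: "'a set \<Rightarrow> 'b set"
  assumes bij: "bij_betw \<phi> {A. scott_closed P A} {B. scott_closed Q B}"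
    and le_iff: "\<lbrakk>scott_closed P A; scott_closed P B\<rbrakk> \<Longrightarrow> \<phi> A \<subseteq> \<phi> B \<longleftrightarrow> A \<subseteq> B"
begin

lemma image_closed: "scott_closed P A \<Longrightarrow> scott_closed Q (\<phi> A)"
  using bij_betwE[OF bij] by simp

lemma preimage: "scott_closed Q B \<Longrightarrow> \<exists>A. scott_closed P A \<and> \<phi> A = B"
  using bij_betw_imp_surj_on[OF bij] by (metis imageE mem_Collect_eq)

lemma preimage_irreducible:
  assumes C: "scott_closed P C" and irr: "scott_irreducible Q (\<phi> C)"
  shows "scott_irreducible P C"
  unfolding scott_irreducible_def
proof (intro conjI allI impI)
  show "scott_closed P C" by (rule C)
  show "C \<noteq> {}"
  proof
    assume "C = {}"
    moreover obtain A where "scott_closed P A" "\<phi> A = {}" using preimage scott_closed_empty by blast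
    ultimately have "\<phi> C \<subseteq> {}" using le_iff[OF C] by blast
    then show False using irr unfolding scott_irreducible_def by blast
  qed
  fix A B assume AB: "scott_closed P A \<and> scott_closed P B \<and> C \<subseteq> A \<union> B"
  then have cl: "scott_closed Q (\<phi> A)" "scott_closed Q (\<phi> B)" using image_closed by blast+
  obtain U where U: "scott_closed P U" "\<phi> U = \<phi> A \<union> \<phi> B"
    using preimage Q.scott_closed_Un[OF cl] by blast
  have "A \<subseteq> U" "B \<subseteq> U" using AB U le_iff by blast+
  then have "\<phi> C \<subseteq> \<phi> A \<union> \<phi> B" using AB U le_iff[OF C U(1)] by auto
  then have "\<phi> C \<subseteq> \<phi> A \<or> \<phi> C \<subseteq> \<phi> B" using irr cl unfolding scott_irreducible_def by blast
  then show "C \<subseteq> A \<or> C \<subseteq> B" using AB C le_iff by blast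
qed

text \<open>
  Principal ideals are ordered like their points, so an order isomorphism that matches the
  principal ideals of the two sides carries the one poset onto the other.
\<close>

lemma principal_correspondence_imp_isomorphic:
  assumes PQ: "\<And>p. p \<in> carrier P \<Longrightarrow> \<exists>q\<in>carrier Q. \<phi> (principal_down P p) = principal_down Q q"
    and QP: "\<And>q. q \<in> carrier Q \<Longrightarrow> \<exists>p\<in>carrier P. \<phi> (principal_down P p) = principal_down Q q"
  shows "poset_isomorphic P Q"
proof -
  obtain f where f: "\<And>p. p \<in> carrier P \<Longrightarrow> f p \<in> carrier Q \<and> \<phi> (principal_down P p) = principal_down Q (f p)"
    using PQ by metis
  have emb: "f x \<sqsubseteq>\<^bsub>Q\<^esub> f y \<longleftrightarrow> x \<sqsubseteq>\<^bsub>P\<^esub> y" if "x \<in> carrier P" "y \<in> carrier P" for x y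
    using that f le_iff P.scott_closed_principal_down P.principal_down_mono_iff
      Q.principal_down_mono_iff by metis
  have "inj_on f (carrier P)"
    using emb f P.le_antisym Q.le_refl by (intro inj_onI) metis
  moreover have "carrier Q \<subseteq> f ` carrier P"
  proof
    fix q assume q: "q \<in> carrier Q"
    then obtain p where p: "p \<in> carrier P" "\<phi> (principal_down P p) = principal_down Q q" using QP by blast
    then have "f p = q" using f q Q.principal_down_mono_iff Q.le_antisym by (metis subset_refl)
    then show "q \<in> f ` carrier P" using p by blast
  qed
  moreover have "order_emb P Q f"
    using emb P.weak_partial_order_axioms Q.weak_partial_order_axioms unfolding order_emb_def by blast
  ultimately show ?thesis unfolding poset_isomorphic_def bij_betw_def using f by blast
qed

end

locale quasicontinuous_scott_closed_iso = scott_closed_iso P Q \<phi> + P: quasicontinuous_dcpo P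
  for P :: "'a gorder" and Q :: "'b gorder" and \<phi> :: "'a set \<Rightarrow> 'b set"
begin

lemma point_of_Q:
  assumes q: "q \<in> carrier Q"
  shows "\<exists>p\<in>carrier P. \<phi> (principal_down P p) = principal_down Q q"
proof -
  obtain C where C: "scott_closed P C" "\<phi> C = principal_down Q q"
    using preimage Q.scott_closed_principal_down[OF q] by blast
  then have "scott_irreducible P C"
    using preimage_irreducible Q.scott_irreducible_principal_down[OF q] by metis
  then show ?thesis using P.sober C by metis
qed

definition emb :: "'b \<Rightarrow> 'a" where
  "emb q = (SOME p. p \<in> carrier P \<and> \<phi> (principal_down P p) = principal_down Q q)"

lemma emb:
  assumes "q \<in> carrier Q"
  shows "emb q \<in> carrier P" "\<phi> (principal_down P (emb q)) = principal_down Q q"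
  using someI_ex[of "\<lambda>p. p \<in> carrier P \<and> \<phi> (principal_down P p) = principal_down Q q"]
    point_of_Q[OF assms] unfolding emb_def by blast+

text \<open>Membership of a point in a closed set is inclusion of its ideal, which \<open>\<phi>\<close> preserves.\<close>

lemma emb_mem_iff:
  assumes q: "q \<in> carrier Q" and A: "scott_closed P A"
  shows "emb q \<in> A \<longleftrightarrow> q \<in> \<phi> A"
  using P.principal_down_least[OF A emb(1)[OF q]] Q.principal_down_least[OF image_closed[OF A] q]
    le_iff[OF P.scott_closed_principal_down[OF emb(1)[OF q]] A] emb(2)[OF q] by simp

lemma emb_le_iff:
  assumes "q \<in> carrier Q" "p \<in> carrier P"
  shows "emb q \<sqsubseteq>\<^bsub>P\<^esub> p \<longleftrightarrow> q \<in> \<phi> (principal_down P p)"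
  using emb_mem_iff[OF assms(1) P.scott_closed_principal_down[OF assms(2)]] emb(1)[OF assms(1)]
  unfolding principal_down_def by simp

lemma emb_le_emb_iff:
  assumes "q \<in> carrier Q" "r \<in> carrier Q"
  shows "emb q \<sqsubseteq>\<^bsub>P\<^esub> emb r \<longleftrightarrow> q \<sqsubseteq>\<^bsub>Q\<^esub> r"
  using emb_le_iff[OF assms(1) emb(1)[OF assms(2)]] emb(2)[OF assms(2)] assms
  unfolding principal_down_def by simp

text \<open>
  Otherwise the points below \<open>x\<close> that \<open>F\<close> is not way below would form a closed set with the
  same trace on the image of \<open>emb\<close> as the ideal of \<open>x\<close>. The two would have equal images under \<open>\<phi>\<close>,
  although only the latter contains \<open>x\<close>.
\<close>

lemma emb_dense:
  assumes x: "x \<in> carrier P" and F: "F \<in> fin_below P x"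
  shows "\<exists>e\<in>emb ` carrier Q. e \<sqsubseteq>\<^bsub>P\<^esub> x \<and> way_below P F e"
proof (rule ccontr)
  assume neg: "\<not> ?thesis"
  let ?B = "{y \<in> principal_down P x. \<not> way_below P F y}"
  have xc: "scott_closed P (principal_down P x)" by (rule P.scott_closed_principal_down[OF x])
  have B: "scott_closed P ?B"
    using P.scott_closed_not_way_below[OF xc] F unfolding fin_below_def by blast
  have "\<phi> (principal_down P x) \<subseteq> \<phi> ?B"
  proof
    fix q assume q: "q \<in> \<phi> (principal_down P x)"
    then have qQ: "q \<in> carrier Q" using scott_closed_carrier[OF image_closed[OF xc]] by blast
    then have "emb q \<in> principal_down P x" using emb_mem_iff[OF qQ xc] q by blast
    moreover from this have "\<not> way_below P F (emb q)"
      using neg qQ unfolding principal_down_def by blast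
    ultimately show "q \<in> \<phi> ?B" using emb_mem_iff[OF qQ B] by blast
  qed
  then have "principal_down P x \<subseteq> ?B" using le_iff[OF xc B] by blast
  then show False
    using P.principal_down_self[OF x] F unfolding fin_below_def by blast
qed

text \<open>
  A point \<open>p\<close> is the supremum of a directed set of values of \<open>emb\<close>. The preimage \<open>D'\<close> of this set
  is directed in \<open>Q\<close>, and \<open>emb\<close> sends its supremum to \<open>p\<close>: above \<open>p\<close> by monotonicity, below \<open>p\<close>
  because the set \<open>\<phi> (principal_down P p)\<close> is Scott closed and contains \<open>D'\<close>.
\<close>

lemma emb_surj:
  assumes p: "p \<in> carrier P"
  shows "\<exists>q\<in>carrier Q. emb q = p"
proof -
  obtain D where D: "directed P D" "D \<subseteq> principal_down P p \<inter> emb ` carrier Q"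
    "principal_down P p = principal_down P (\<Squnion>\<^bsub>P\<^esub>D)"
    by (rule P.irreducible_principal[OF P.scott_irreducible_principal_down[OF p], of "emb ` carrier Q"])
      (use emb emb_dense in blast)+
  have p_eq: "p = \<Squnion>\<^bsub>P\<^esub>D"
    using D(3) p P.sup_carrier[OF D(1)] P.principal_down_mono_iff P.le_antisym by (metis subset_refl)
  define D' where "D' = {q \<in> carrier Q. emb q \<in> D}"
  have D_eq: "D = emb ` D'" using D(2) unfolding D'_def by blast
  have "D' \<noteq> {}" using D(1) D_eq unfolding directed_def by blast
  moreover have "\<exists>z\<in>D'. x \<sqsubseteq>\<^bsub>Q\<^esub> z \<and> y \<sqsubseteq>\<^bsub>Q\<^esub> z" if xy: "x \<in> D'" "y \<in> D'" for x y
  proof -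
    obtain z where "z \<in> D'" "emb x \<sqsubseteq>\<^bsub>P\<^esub> emb z" "emb y \<sqsubseteq>\<^bsub>P\<^esub> emb z"
      using D(1) xy unfolding D_eq directed_def by blast
    then show ?thesis using emb_le_emb_iff xy unfolding D'_def by blast
  qed
  ultimately have dir: "directed Q D'" unfolding directed_def D'_def by blast
  let ?s = "\<Squnion>\<^bsub>Q\<^esub>D'"
  have s: "?s \<in> carrier Q" by (rule Q.sup_carrier[OF dir])
  have "p \<sqsubseteq>\<^bsub>P\<^esub> emb ?s"
    unfolding p_eq
  proof (rule P.sup_least[OF D(1) emb(1)[OF s]])
    fix d assume "d \<in> D"
    then obtain q where "q \<in> D'" "d = emb q" using D_eq by blast
    then show "d \<sqsubseteq>\<^bsub>P\<^esub> emb ?s"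
      using Q.sup_upper[OF dir] emb_le_emb_iff s unfolding D'_def by blast
  qed
  moreover have "D' \<subseteq> \<phi> (principal_down P p)"
    using emb_mem_iff[OF _ P.scott_closed_principal_down[OF p]] D(2) unfolding D'_def by blast
  then have "?s \<in> \<phi> (principal_down P p)"
    using scott_closed_sup[OF image_closed[OF P.scott_closed_principal_down[OF p]] dir] by blast
  then have "emb ?s \<sqsubseteq>\<^bsub>P\<^esub> p" using emb_le_iff[OF s p] by blast
  ultimately have "emb ?s = p" using P.le_antisym emb(1)[OF s] p by blast
  then show ?thesis using s by blast
qed

lemma isomorphic: "poset_isomorphic P Q"
  using principal_correspondence_imp_isomorphic point_of_Q emb_surj emb(2) by metis

end

theorem lemma3p8:
  fixes P :: "'a gorder"
  assumes "quasicontinuous_dcpo P"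
  shows "SCL_faithful TYPE('b) P"
proof -
  interpret P: quasicontinuous_dcpo P by (rule assms)
  have "poset_isomorphic P Q"
    if Q: "dcpo Q" and iso: "lattice_isomorphic (C_sigma P) (C_sigma Q)" for Q :: "'b gorder"
  proof -
    interpret Q: dcpo Q by (rule Q)
    obtain \<phi> where \<phi>: "bij_betw \<phi> (carrier (C_sigma P)) (carrier (C_sigma Q))"
      "\<And>A B. \<lbrakk>A \<in> carrier (C_sigma P); B \<in> carrier (C_sigma P)\<rbrakk>
        \<Longrightarrow> \<phi> A \<sqsubseteq>\<^bsub>C_sigma Q\<^esub> \<phi> B \<longleftrightarrow> A \<sqsubseteq>\<^bsub>C_sigma P\<^esub> B"
      by (rule lattice_isomorphic_imp_order_iso[OF iso]) blast
    interpret quasicontinuous_scott_closed_iso P Q \<phi>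
      by unfold_locales (use \<phi> in \<open>auto simp: C_sigma_def\<close>)
    show ?thesis by (rule isomorphic)
  qed
  then show ?thesis
    unfolding SCL_faithful_def using P.dcpo_axioms by blast
qed

end
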